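(* Let $p$ be a prime and $k=ap^h$ with $h\ge 0$ and $1\le a\le p-1$. Then $s(n,k)$ is a minimum zero case for every integer $n$ with $k\le n<kp$ and $(p-1)\mid(n-k)$.
   Context: $s(n,k)$ is the signed Stirling number of the first kind, defined by $x(x-1)\cdots(x-n+1)=\sum_k s(n,k)x^k$. $\nu_p$ is the $p$-adic valuation and $\sigma_p(m)$ the base-$p$ digit sum. $s(n,k)$ is called a minimum zero case if $\nu_p(s(n,k))=(\sigma_p(k-1)-\sigma_p(n-1))/(p-1)$. *)

theory Defs
  imports Complex_Main "HOL-Computational_Algebra.Computational_Algebra" "HOL-Combinatorics.Stirling"
begin

text \<open>
  The signed Stirling number of the first kind: the coefficient of \<open>x ^ k\<close> in
  \<open>x (x - 1) \<dots> (x - n + 1)\<close>. The library's \<^const>\<open>stirling\<close> is its absolute value.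
\<close>

definition signed_stirling :: "nat \<Rightarrow> nat \<Rightarrow> int" where
  "signed_stirling n k = poly.coeff (\<Prod>i<n. [:- int i, 1:]) k"

text \<open>
  The digit of \<open>m\<close> at position \<open>i\<close> in base \<open>p \<ge> 2\<close> is \<open>(m div p ^ i) mod p\<close>; it
  vanishes for \<open>i > m\<close>, since then \<open>p ^ i > m\<close>, so the sum runs over all nonzero digits.
\<close>

definition digit_sum :: "nat \<Rightarrow> nat \<Rightarrow> nat" where
  "digit_sum p m = (\<Sum>i\<le>m. (m div p ^ i) mod p)"

text \<open>
  The valuation of \<open>0\<close> is infinite, whereas \<^const>\<open>multiplicity\<close> is then \<open>0\<close>; hence the
  nonvanishing conjunct. The quotient need not be an integer a priori and is taken in the
  reals. The notion is meant for \<open>n, k \<ge> 1\<close>, where the subtractions in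
  \<open>n - 1\<close> and \<open>k - 1\<close> do not truncate.
\<close>

definition minimum_zero_case :: "nat \<Rightarrow> nat \<Rightarrow> nat \<Rightarrow> bool" where
  "minimum_zero_case p n k \<longleftrightarrow>
     signed_stirling n k \<noteq> 0 \<and>
     real (multiplicity (int p) (signed_stirling n k)) =
       (real (digit_sum p (k - 1)) - real (digit_sum p (n - 1))) / (real p - 1)"

end

theory Submission
  imports Defs
begin

text \<open>
  Put \<open>\<Lambda>(t) = ln (1 + t) / t\<close>. Differentiating \<open>\<Sum>n. s(n,k) t^n / n! = ln (1 + t)^k / k!\<close> gives
  \<open>(k - 1)! s(n,k) = (n - 1)! [t^(n-k)] \<Lambda>(t)^(k-1) / (1 + t)\<close>. Give \<open>t\<close> the valuation \<open>1 / (p - 1)\<close>.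
  Then all terms \<open>(-t)^j / (j + 1)\<close> of \<open>\<Lambda>\<close> have nonnegative valuation, which vanishes only for
  \<open>j = 0\<close> and \<open>j = p - 1\<close>, and \<open>1 / (1 + t)\<close> reduces to \<open>1\<close>. So, up to terms of positive valuation,
  the series is \<open>(1 \<plusminus> t^(p-1) / p)^(k-1)\<close>, and its coefficient at \<open>n - k = (p - 1) r\<close> has valuation
  exactly \<open>-r\<close> because \<open>k - 1 choose r\<close> is prime to \<open>p\<close>: the base-\<open>p\<close> digits of \<open>k - 1\<close> are
  \<open>a - 1, p - 1, \<dots>, p - 1\<close>. Legendre's formula for the two factorials then yields the claim.
\<close>

section \<open>Digit sums and Legendre's formula\<close>

lemma digit_sum_rec:
  assumes "p \<ge> 2"
  shows "digit_sum p m = m mod p + digit_sum p (m div p)"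
proof (cases "m = 0")
  case True
  then show ?thesis by (simp add: digit_sum_def)
next
  case False
  \<comment> \<open>The range of summation in \<open>digit_sum\<close> depends on its argument.
    Padding with zero digits makes the sums for \<open>m\<close> and \<open>m div p\<close>
    comparable.\<close>
  have extend: "digit_sum p l = (\<Sum>i<N. (l div p ^ i) mod p)" if "l < N" for l N
    unfolding digit_sum_def
  proof (rule sum.mono_neutral_left)
    show "\<forall>i\<in>{..<N} - {..l}. (l div p ^ i) mod p = 0"
    proof
      fix i assume "i \<in> {..<N} - {..l}"
      then have "l < i" by auto
      also have "i < p ^ i" using assms by (intro power_gt_expt) auto
      finally show "(l div p ^ i) mod p = 0" by simp
    qed
  qed (use that in auto)
  have "digit_sum p m = (\<Sum>i<Suc m. (m div p ^ i) mod p)"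
    by (rule extend) simp
  also have "\<dots> = m mod p + (\<Sum>i<m. (m div p div p ^ i) mod p)"
    by (simp add: sum.lessThan_Suc_shift div_mult2_eq del: sum.lessThan_Suc)
  also have "(\<Sum>i<m. (m div p div p ^ i) mod p) = digit_sum p (m div p)"
    using False assms by (intro extend [symmetric]) auto
  finally show ?thesis .
qed

text \<open>Adding 1 turns each trailing digit \<open>p - 1\<close> of \<open>m\<close> into 0, and
  the number of these digits is the valuation of \<open>Suc m\<close>. The induction strips one such
  digit at a time.\<close>

lemma digit_sum_Suc:
  assumes "prime p"
  shows "(p - 1) * multiplicity (int p) (int (Suc m)) + digit_sum p (Suc m) = digit_sum p m + 1"
proof (induction m rule: less_induct)
  case (less m)
  have p2: "p \<ge> 2" using assms by (rule prime_ge_2_nat)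
  show ?case
  proof (cases "p dvd Suc m")
    case False
    then have "multiplicity (int p) (int (Suc m)) = 0"
      by (intro not_dvd_imp_multiplicity_0) (simp only: int_dvd_int_iff not_False_eq_True)
    moreover have "Suc m mod p = Suc (m mod p)" "Suc m div p = m div p"
      using False by (auto simp: mod_Suc div_Suc dvd_eq_mod_eq_0)
    ultimately show ?thesis
      using digit_sum_rec[OF p2, of m] digit_sum_rec[OF p2, of "Suc m"] by simp
  next
    case True
    then obtain q where q: "Suc m = p * q" by (elim dvdE)
    then obtain l where l: "q = Suc l" by (cases q) auto
    have m: "m = p * l + (p - 1)" using q l p2 by (simp add: algebra_simps)
    have div_mod: "m mod p = p - 1" "m div p = l"
      unfolding m using p2 by (subst mod_mult_self4 div_mult_self4; simp)+
    have "2 * l \<le> p * l" using p2 by (intro mult_right_mono) auto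
    then have "l < m" using m p2 by linarith
    then have IH: "(p - 1) * multiplicity (int p) (int (Suc l)) + digit_sum p (Suc l) =
      digit_sum p l + 1" by (rule less)
    have "multiplicity (int p) (int (Suc m)) = Suc (multiplicity (int p) (int (Suc l)))"
      unfolding q l of_nat_mult using p2 by (intro multiplicity_times_same) auto
    moreover have "digit_sum p (Suc m) = digit_sum p (Suc l)"
      using digit_sum_rec[OF p2, of "Suc m"] p2 by (simp add: q l del: mult_Suc_right)
    moreover have "digit_sum p m = p - 1 + digit_sum p l"
      using digit_sum_rec[OF p2, of m] by (simp add: div_mod)
    ultimately show ?thesis using IH by simp
  qed
qed

text \<open>Legendre's formula, by summing \<open>digit_sum_Suc\<close> over the factors of the
  factorial.\<close>

lemma legendre_digit_sum:
  assumes "prime p"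
  shows "(p - 1) * multiplicity (int p) (fact m) + digit_sum p m = m"
proof (induction m)
  case 0
  then show ?case by (simp add: digit_sum_def)
next
  case (Suc m)
  have "prime_elem (int p)" using assms by simp
  then have "multiplicity (int p) (fact (Suc m)) =
      multiplicity (int p) (int (Suc m)) + multiplicity (int p) (fact m)"
    unfolding fact_Suc by (subst prime_elem_multiplicity_mult_distrib) simp_all
  then show ?case using Suc digit_sum_Suc[OF assms, of m] by (simp add: algebra_simps)
qed

section \<open>Binomial coefficients prime to p\<close>

text \<open>Write \<open>i = p ^ e * q\<close> with \<open>q\<close> prime to \<open>p\<close>; the
  size of \<open>i\<close> forces \<open>e \<le> h\<close>. If \<open>e < h\<close>, then
  \<open>a * p ^ h\<close> has the larger valuation; if \<open>e = h\<close>, the cofactor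
  \<open>a - q\<close> lies strictly between 0 and \<open>p\<close>.\<close>

lemma multiplicity_digit_prime_power_diff:
  fixes p :: nat
  assumes "prime p" "a < p" "0 < i" "i < a * p ^ h"
  shows "multiplicity p (a * p ^ h - i) = multiplicity p i"
proof -
  have p2: "p \<ge> 2" using assms(1) by (rule prime_ge_2_nat)
  define e where "e = multiplicity p i"
  obtain q where q: "i = p ^ e * q" "\<not> p dvd q"
    unfolding e_def using assms(1,3) by (metis multiplicity_decompose' not_prime_unit neq0_conv)
  have "p ^ e < p ^ Suc h"
  proof -
    have "p ^ e \<le> i" using q assms(3) by (cases q) auto
    also have "i < a * p ^ h" by fact
    also have "\<dots> \<le> p ^ Suc h" using assms(2) by simp
    finally show ?thesis .
  qed
  then have eh: "e \<le> h" using p2 by (simp add: less_Suc_eq_le del: power_Suc)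
  have diff: "a * p ^ h - i = p ^ e * (a * p ^ (h - e) - q)"
    using eh q(1) by (simp add: diff_mult_distrib2 mult.left_commute flip: power_add)
  have qlt: "q < a * p ^ (h - e)"
  proof -
    have "p ^ e * (a * p ^ (h - e) - q) > 0" using assms(4) unfolding diff[symmetric] by simp
    then show ?thesis by (simp only: nat_0_less_mult_iff zero_less_diff)
  qed
  have "\<not> p dvd a * p ^ (h - e) - q"
  proof (cases "e = h")
    case True
    then show ?thesis using qlt assms(2) by (auto dest: dvd_imp_le)
  next
    case False
    then have "p dvd a * p ^ (h - e)" using eh by simp
    then show ?thesis using q(2) qlt by (metis dvd_diffD1 less_imp_le)
  qed
  then show ?thesis
    unfolding diff e_def[symmetric] using p2 assms(1)
    by (intro multiplicity_eqI) (auto simp: mult.commute)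
qed

text \<open>With \<open>k = a * p ^ h\<close>, passing from \<open>r\<close> to \<open>Suc r\<close>
  multiplies the binomial coefficient by \<open>(k - Suc r) / Suc r\<close>, whose numerator and
  denominator have equal valuation by the previous lemma.\<close>

lemma binomial_digit_prime_power_not_dvd:
  fixes p :: nat
  assumes "prime p" "a < p" "r < a * p ^ h"
  shows "\<not> p dvd ((a * p ^ h - 1) choose r)"
proof -
  have "multiplicity p ((a * p ^ h - 1) choose r) = 0"
    using assms(3)
  proof (induction r)
    case (Suc r)
    define k where "k = a * p ^ h"
    have r: "r < k - 1" using Suc.prems by (simp add: k_def)
    have pe: "prime_elem p" using assms(1) by simp
    have "((k - 1) choose Suc r) * Suc r = ((k - 1) choose r) * (k - Suc r)"
      using binomial_absorb_comp[of "k - 1" r] binomial_absorption[of r "k - 1"]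
      by (simp add: mult.commute)
    then have "multiplicity p (((k - 1) choose Suc r) * Suc r) =
        multiplicity p (((k - 1) choose r) * (k - Suc r))" by simp
    moreover have "multiplicity p (((k - 1) choose Suc r) * Suc r) =
        multiplicity p ((k - 1) choose Suc r) + multiplicity p (Suc r)"
      using r by (intro prime_elem_multiplicity_mult_distrib pe) auto
    moreover have "multiplicity p (((k - 1) choose r) * (k - Suc r)) =
        multiplicity p ((k - 1) choose r) + multiplicity p (k - Suc r)"
      using r by (intro prime_elem_multiplicity_mult_distrib pe) auto
    moreover have "multiplicity p (k - Suc r) = multiplicity p (Suc r)"
      unfolding k_def using assms(1,2) Suc.prems
      by (intro multiplicity_digit_prime_power_diff) auto
    ultimately show ?case using Suc unfolding k_def by simp
  qed simp
  moreover have "(a * p ^ h - 1) choose r \<noteq> 0" using assms(3) by simp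
  ultimately show ?thesis
    using assms(1) by (metis not_prime_unit multiplicity_eq_zero_iff)
qed

section \<open>Stirling numbers as coefficients of powers of the logarithm\<close>

lemma coeff_linear_mult_Suc:
  fixes q :: "'a::comm_ring_1 poly"
  shows "poly.coeff (q * [:c, 1:]) (Suc k) = poly.coeff q k + c * poly.coeff q (Suc k)"
  by (simp add: mult.commute[of q])

text \<open>Compare coefficients in \<open>(1 + X) (L ^ Suc k)' = Suc k * L ^ k\<close>. Up to
  factorials this is the recurrence of the signed Stirling numbers.\<close>

lemma fps_ln_power_recurrence:
  fixes L :: "rat fps"
  defines "L \<equiv> fps_ln 1"
  shows "of_nat (Suc n) * (L ^ Suc k) $ Suc n + of_nat n * (L ^ Suc k) $ n =
    of_nat (Suc k) * (L ^ k) $ n"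
proof -
  have "(1 + fps_X) * fps_deriv L = 1"
    unfolding L_def fps_ln_deriv by (simp add: inverse_mult_eq_1')
  then have "(1 + fps_X) * fps_deriv (L ^ Suc k) = of_nat (Suc k) * L ^ k"
    unfolding fps_deriv_power' by (simp add: mult_ac del: of_nat_Suc)
  from arg_cong[OF this, of "\<lambda>f. f $ n"] show ?thesis
    by (cases n) (simp_all add: distrib_right fps_of_nat[symmetric] del: of_nat_Suc power_Suc)
qed

lemma signed_stirling_fps_ln:
  "of_int (signed_stirling n k) * fact k = (fact n * (fps_ln 1 ^ k) $ n :: rat)"
proof (induction n arbitrary: k)
  case 0
  then show ?case by (cases k) (simp_all add: signed_stirling_def)
next
  case (Suc n)
  show ?case
  proof (cases k)
    case 0
    then show ?thesis
      by (auto simp: signed_stirling_def poly_0_coeff_0 [symmetric] poly_prod prod_zero_iff)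
  next
    case (Suc l)
    have "signed_stirling (Suc n) (Suc l) = signed_stirling n l - int n * signed_stirling n (Suc l)"
      unfolding signed_stirling_def by (simp add: coeff_linear_mult_Suc)
    then have "of_int (signed_stirling (Suc n) (Suc l)) * fact (Suc l) =
       (of_nat (Suc l) * (of_int (signed_stirling n l) * fact l) -
         of_nat n * (of_int (signed_stirling n (Suc l)) * fact (Suc l)) :: rat)"
      by (simp only: of_int_diff of_int_mult of_int_of_nat_eq fact_Suc) (simp add: algebra_simps)
    also have "\<dots> = fact n * (of_nat (Suc l) * (fps_ln 1 ^ l) $ n - of_nat n * (fps_ln 1 ^ Suc l) $ n)"
      unfolding Suc.IH by (simp add: algebra_simps)
    also have "\<dots> = fact n * (of_nat (Suc n) * (fps_ln 1 ^ Suc l) $ Suc n)"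
      unfolding fps_ln_power_recurrence[symmetric] by simp
    also have "\<dots> = fact (Suc n) * (fps_ln 1 ^ Suc l) $ Suc n"
      by (simp add: algebra_simps)
    finally show ?thesis using Suc by simp
  qed
qed

definition log_series :: "rat fps" where
  "log_series = Abs_fps (\<lambda>j. (-1) ^ j / of_nat (Suc j))"

lemma fps_ln_eq_log_series: "fps_ln 1 = fps_X * log_series"
  by (intro fps_ext) (simp add: log_series_def fps_ln_nth of_nat_diff)

text \<open>Differentiation lowers the exponent to \<open>k - 1\<close>, whose base-\<open>p\<close>
  digits below the leading one are all \<open>p - 1\<close> in the application, and brings in the
  factorials of \<open>n - 1\<close> and \<open>k - 1\<close> that produce the two digit
  sums.\<close>

lemma signed_stirling_log_series:
  assumes "1 \<le> k" "k \<le> n"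
  shows "of_int (signed_stirling n k) * fact (k - 1) =
    (fact (n - 1) * (log_series ^ (k - 1) * inverse (1 + fps_X)) $ (n - k) :: rat)"
proof -
  obtain l m where lm: "k = Suc l" "n = Suc m" using assms by (metis Suc_le_D le_trans One_nat_def)
  let ?L = "fps_ln 1 :: rat fps"
  have "fps_deriv (?L ^ Suc l) = of_nat (Suc l) * (?L ^ l * inverse (1 + fps_X))"
    unfolding fps_deriv_power' fps_ln_deriv by (simp add: mult_ac del: of_nat_Suc)
  from arg_cong[OF this, of "\<lambda>f. f $ m"]
  have "of_nat (Suc m) * (?L ^ Suc l) $ Suc m = of_nat (Suc l) * (?L ^ l * inverse (1 + fps_X)) $ m"
    by (simp add: fps_of_nat[symmetric] del: of_nat_Suc power_Suc)
  moreover have "(?L ^ l * inverse (1 + fps_X)) $ m = (log_series ^ l * inverse (1 + fps_X)) $ (m - l)"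
    using assms unfolding fps_ln_eq_log_series lm
    by (simp add: power_mult_distrib mult.assoc fps_X_power_mult_nth)
  moreover have "of_int (signed_stirling (Suc m) (Suc l)) * (of_nat (Suc l) * fact l) =
      fact m * (of_nat (Suc m) * (?L ^ Suc l) $ Suc m)"
    using signed_stirling_fps_ln[of "Suc m" "Suc l"] by (simp add: algebra_simps)
  ultimately have "of_nat (Suc l) * (of_int (signed_stirling (Suc m) (Suc l)) * fact l) =
      of_nat (Suc l) * (fact m * (log_series ^ l * inverse (1 + fps_X)) $ (m - l))"
    by (simp add: mult_ac del: of_nat_Suc)
  then show ?thesis unfolding lm by (simp del: of_nat_Suc)
qed

section \<open>Scaled lower bounds for valuations of rationals\<close>

text \<open>
  The bound \<open>(p - 1) \<nu>\<^sub>p(x) \<ge> s\<close>; the factor \<open>p - 1\<close> avoids fractional valuations.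
\<close>

definition scaled_val_ge :: "nat \<Rightarrow> int \<Rightarrow> rat \<Rightarrow> bool" where
  "scaled_val_ge p s x \<longleftrightarrow> (\<exists>i a b. \<not> int p dvd b \<and> s \<le> (int p - 1) * i \<and>
     x = of_int a / of_int b * of_nat p powi i)"

lemma scaled_val_geI:
  assumes "\<not> int p dvd b" "s \<le> (int p - 1) * i" "x = of_int a / of_int b * of_nat p powi i"
  shows "scaled_val_ge p s x"
  using assms unfolding scaled_val_ge_def by blast

lemma scaled_val_ge_0 [simp]:
  assumes "prime p"
  shows "scaled_val_ge p s 0"
proof (rule scaled_val_geI)
  show "\<not> int p dvd 1" using assms by (simp add: prime_nat_iff)
  \<comment> \<open>The numerator in \<open>scaled_val_ge\<close> may vanish, so any large enough
    exponent serves as a witness; \<open>\<bar>s\<bar>\<close> works because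
    \<open>p - 1 \<ge> 1\<close>.\<close>
  have "s \<le> 1 * \<bar>s\<bar>" by simp
  also have "\<dots> \<le> (int p - 1) * \<bar>s\<bar>"
    using prime_ge_2_nat[OF assms] by (intro mult_right_mono) auto
  finally show "s \<le> (int p - 1) * \<bar>s\<bar>" .
  show "0 = of_int 0 / of_int 1 * (of_nat p powi \<bar>s\<bar> :: rat)" by simp
qed

lemma scaled_val_ge_add:
  assumes "prime p" "scaled_val_ge p s x" "scaled_val_ge p s y"
  shows "scaled_val_ge p s (x + y)"
proof -
  have p0: "p \<noteq> 0" using assms(1) by auto
  obtain i a b where x: "\<not> int p dvd b" "s \<le> (int p - 1) * i"
      "x = of_int a / of_int b * of_nat p powi i"
    using assms(2) unfolding scaled_val_ge_def by blast
  obtain j c d where y: "\<not> int p dvd d" "s \<le> (int p - 1) * j"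
      "y = of_int c / of_int d * of_nat p powi j"
    using assms(3) unfolding scaled_val_ge_def by blast
  have bd: "\<not> int p dvd b * d" "b \<noteq> 0" "d \<noteq> 0"
    using x(1) y(1) assms(1) by (auto simp: prime_dvd_mult_iff)
  define l where "l = min i j"
  have powi: "of_nat p powi t = (of_int (int p ^ nat (t - l)) * of_nat p powi l :: rat)" if "l \<le> t" for t
  proof -
    have "of_nat p powi t = (of_nat p powi (t - l) * of_nat p powi l :: rat)"
      using p0 by (simp flip: power_int_add)
    also have "of_nat p powi (t - l) = (of_int (int p ^ nat (t - l)) :: rat)"
      using that by (simp add: power_int_def)
    finally show ?thesis .
  qed
  have "x + y = of_int (a * int p ^ nat (i - l) * d + c * int p ^ nat (j - l) * b) / of_int (b * d) *
      of_nat p powi l"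
    unfolding x(3) y(3) powi[of i, unfolded l_def, OF min.cobounded1, folded l_def]
      powi[of j, unfolded l_def, OF min.cobounded2, folded l_def]
    using bd by (simp add: field_simps)
  moreover have "s \<le> (int p - 1) * l" using x(2) y(2) unfolding l_def by (simp add: min_def)
  ultimately show ?thesis using bd(1) by (intro scaled_val_geI)
qed

lemma scaled_val_ge_mult:
  assumes "prime p" "scaled_val_ge p s x" "scaled_val_ge p t y"
  shows "scaled_val_ge p (s + t) (x * y)"
proof -
  have p0: "p \<noteq> 0" using assms(1) by auto
  obtain i a b where x: "\<not> int p dvd b" "s \<le> (int p - 1) * i"
      "x = of_int a / of_int b * of_nat p powi i"
    using assms(2) unfolding scaled_val_ge_def by blast
  obtain j c d where y: "\<not> int p dvd d" "t \<le> (int p - 1) * j"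
      "y = of_int c / of_int d * of_nat p powi j"
    using assms(3) unfolding scaled_val_ge_def by blast
  show ?thesis
  proof (rule scaled_val_geI)
    show "\<not> int p dvd b * d" using x(1) y(1) assms(1) by (auto simp: prime_dvd_mult_iff)
    show "s + t \<le> (int p - 1) * (i + j)" using x(2) y(2) by (simp add: distrib_left)
    show "x * y = of_int (a * c) / of_int (b * d) * of_nat p powi (i + j)"
      unfolding x(3) y(3) using p0 by (simp add: power_int_add)
  qed
qed

lemma scaled_val_ge_of_int:
  assumes "prime p" "s \<le> 0"
  shows "scaled_val_ge p s (of_int a)"
  using assms by (intro scaled_val_geI[of p 1 s 0 _ a]) (auto simp: prime_nat_iff)

text \<open>A positive scaled bound forces the integer exponent to be at least 1. This turns
  valuations back into divisibility by \<open>p\<close>.\<close>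

lemma scaled_val_ge_pos:
  assumes "scaled_val_ge p 1 x" "p \<ge> 1"
  obtains a b where "\<not> int p dvd b" "x * of_int b = of_int (int p * a)"
proof -
  obtain i a b where x: "\<not> int p dvd b" "1 \<le> (int p - 1) * i"
      "x = of_int a / of_int b * of_nat p powi i"
    using assms(1) unfolding scaled_val_ge_def by blast
  have "i \<ge> 1"
  proof (rule ccontr)
    assume "\<not> ?thesis"
    then have "(int p - 1) * i \<le> 0" using assms(2) by (intro mult_nonneg_nonpos) auto
    with x(2) show False by simp
  qed
  define m where "m = nat (i - 1)"
  have m: "i = int (Suc m)" using \<open>i \<ge> 1\<close> by (simp add: m_def)
  show ?thesis
  proof
    show "\<not> int p dvd b" by fact
    have "b \<noteq> 0" using x(1) by auto
    then show "x * of_int b = of_int (int p * (a * int p ^ m))"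
      unfolding x(3) m power_int_of_nat by simp
  qed
qed

section \<open>Gauss valuation on power series\<close>

text \<open>
  The Gauss valuation for which \<open>t\<close> has valuation \<open>1 / (p - 1)\<close>, again scaled by \<open>p - 1\<close>:
  the series at level \<open>0\<close> form a ring, in which those at level \<open>1\<close> are an ideal.
\<close>

definition gauss_val_ge :: "nat \<Rightarrow> int \<Rightarrow> rat fps \<Rightarrow> bool" where
  "gauss_val_ge p c f \<longleftrightarrow> (\<forall>j. scaled_val_ge p (c - int j) (f $ j))"

lemma gauss_val_ge_add:
  "\<lbrakk>prime p; gauss_val_ge p c f; gauss_val_ge p c g\<rbrakk> \<Longrightarrow> gauss_val_ge p c (f + g)"
  by (simp add: gauss_val_ge_def scaled_val_ge_add)

lemma gauss_val_ge_mult: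
  assumes "prime p" "gauss_val_ge p c f" "gauss_val_ge p d g"
  shows "gauss_val_ge p (c + d) (f * g)"
  unfolding gauss_val_ge_def
proof
  fix j
  \<comment> \<open>Inducting over subsets of \<open>{0..j}\<close> keeps \<open>i \<le> j\<close>
    at hand, so that \<open>j - i\<close> does not truncate.\<close>
  have "scaled_val_ge p (c + d - int j) (\<Sum>i\<in>I. f $ i * g $ (j - i))" if "finite I" "I \<subseteq> {0..j}" for I
    using that
  proof (induction I rule: finite_induct)
    case (insert i I)
    have "scaled_val_ge p ((c - int i) + (d - int (j - i))) (f $ i * g $ (j - i))"
      using assms by (intro scaled_val_ge_mult) (auto simp: gauss_val_ge_def)
    then have "scaled_val_ge p (c + d - int j) (f $ i * g $ (j - i))"
      using insert.prems by (simp add: of_nat_diff algebra_simps)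
    then show ?case using insert assms(1) by (simp add: scaled_val_ge_add)
  qed (use assms in simp)
  then show "scaled_val_ge p (c + d - int j) ((f * g) $ j)"
    unfolding fps_mult_nth by blast
qed

lemma gauss_val_ge_uminus:
  assumes "prime p" "gauss_val_ge p c f"
  shows "gauss_val_ge p c (- f)"
proof -
  have "scaled_val_ge p (0 + (c - int j)) (of_int (- 1) * f $ j)" for j
    using assms by (intro scaled_val_ge_mult scaled_val_ge_of_int) (auto simp: gauss_val_ge_def)
  then show ?thesis by (simp add: gauss_val_ge_def)
qed

lemma gauss_val_ge_1: "prime p \<Longrightarrow> gauss_val_ge p 0 1"
  using scaled_val_ge_of_int[of p 0 1] by (simp add: gauss_val_ge_def fps_one_nth)

lemma gauss_val_ge_power: "\<lbrakk>prime p; gauss_val_ge p 0 f\<rbrakk> \<Longrightarrow> gauss_val_ge p 0 (f ^ K)"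
  using gauss_val_ge_mult[of p 0 _ 0] by (induction K) (simp_all add: gauss_val_ge_1)

lemma gauss_val_ge_power_diff:
  assumes "prime p" "gauss_val_ge p 0 f" "gauss_val_ge p 0 g" "gauss_val_ge p 1 (f - g)"
  shows "gauss_val_ge p 1 (f ^ K - g ^ K)"
proof (induction K)
  case 0
  then show ?case using assms(1) by (simp add: gauss_val_ge_def)
next
  case (Suc K)
  have "gauss_val_ge p (0 + 1) (f * (f ^ K - g ^ K))"
    using assms Suc by (intro gauss_val_ge_mult)
  moreover have "gauss_val_ge p (1 + 0) ((f - g) * g ^ K)"
    using assms by (intro gauss_val_ge_mult gauss_val_ge_power)
  ultimately have "gauss_val_ge p 1 (f * (f ^ K - g ^ K) + (f - g) * g ^ K)"
    using assms(1) by (intro gauss_val_ge_add) simp_all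
  then show ?case by (simp add: algebra_simps)
qed

section \<open>Reduction of the logarithmic series to a binomial power\<close>

text \<open>If \<open>Suc j = p ^ e * q\<close> with \<open>q\<close> prime to \<open>p\<close>, the
  scaled valuation is \<open>-e (p - 1)\<close>. Bernoulli's inequality
  \<open>1 + e (p - 1) \<le> p ^ e\<close> gives \<open>e (p - 1) \<le> j\<close>, with equality
  only at the two excluded indices.\<close>

lemma scaled_val_ge_log_coeff:
  assumes "prime p"
  shows "scaled_val_ge p (- int j) ((-1) ^ j / of_nat (Suc j))"
    and "j \<noteq> 0 \<Longrightarrow> j \<noteq> p - 1 \<Longrightarrow> scaled_val_ge p (1 - int j) ((-1) ^ j / of_nat (Suc j))"
proof -
  have p2: "p \<ge> 2" using assms by (rule prime_ge_2_nat)
  obtain e q where q: "Suc j = p ^ e * q" "\<not> p dvd q"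
    using assms by (metis multiplicity_decompose' not_prime_unit nat.distinct(1))
  then have q0: "q \<ge> 1" by (cases q) auto
  have bern: "1 + int t * (int p - 1) \<le> int p ^ t" for t
  proof -
    have "real_of_int (1 + int t * (int p - 1)) \<le> real_of_int (int p ^ t)"
      using Bernoulli_inequality[of "real p - 1" t] p2 by simp
    then show ?thesis by (simp only: of_int_le_iff)
  qed
  have j: "int j = int p ^ e * int q - 1"
    using arg_cong[OF q(1), of int] by simp
  have pe: "int p ^ e * 1 \<le> int p ^ e * int q" using q0 by (intro mult_left_mono) auto
  have rep: "scaled_val_ge p s ((-1) ^ j / of_nat (Suc j))" if "s \<le> - (int e * (int p - 1))" for s
  proof (rule scaled_val_geI)
    show "\<not> int p dvd int q" using q(2) by simp
    show "s \<le> (int p - 1) * (- int e)" using that by (simp add: mult.commute)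
    show "(-1) ^ j / of_nat (Suc j) = of_int ((-1) ^ j) / of_int (int q) * (of_nat p powi (- int e) :: rat)"
      unfolding q(1) by (simp add: power_int_minus field_simps)
  qed
  show "scaled_val_ge p (- int j) ((-1) ^ j / of_nat (Suc j))"
    using bern[of e] pe j by (intro rep) linarith
  assume j0: "j \<noteq> 0" "j \<noteq> p - 1"
  have "int e * (int p - 1) < int j"
  proof -
    \<comment> \<open>Strictness comes from \<open>j > 0\<close> for \<open>e = 0\<close> and from
      \<open>q \<ge> 2\<close> for \<open>e = 1\<close>. For \<open>e \<ge> 2\<close>, Bernoulli at
      \<open>e - 1\<close>, multiplied by \<open>p\<close>, leaves room to spare.\<close>
    consider "e = 0" | "e = 1" | t where "e = Suc t" "t \<ge> 1"
      by (metis One_nat_def Suc_leI not0_implies_Suc gr0I)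
    then show ?thesis
    proof cases
      case 1
      then show ?thesis using j0 by simp
    next
      case 2
      then have "q \<noteq> 1" using q(1) j0 by auto
      then have "int p * 2 \<le> int p * int q" using q0 by (intro mult_left_mono) auto
      then show ?thesis using 2 j p2 by simp
    next
      case 3
      define T where "T = int t * (int p - 1)"
      have "int p * (1 + T) \<le> int p * int p ^ t"
        using bern[of t] unfolding T_def by (intro mult_left_mono) auto
      then have "int p + int p * T \<le> int p ^ e" unfolding 3(1) by (simp add: distrib_left)
      moreover have "0 < T" using 3 p2 unfolding T_def by simp
      moreover from this have "2 * T \<le> int p * T"
        using p2 by (intro mult_right_mono) auto
      moreover have "int e * (int p - 1) = T + int p - 1"
        unfolding T_def 3(1) by (simp add: algebra_simps)
      ultimately show ?thesis using pe j by linarith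
    qed
  qed
  then show "scaled_val_ge p (1 - int j) ((-1) ^ j / of_nat (Suc j))"
    by (intro rep) linarith
qed

lemma fps_nth_power_one_plus_monom:
  fixes c :: "'a::comm_ring_1"
  assumes "d > 0" "r \<le> K"
  shows "((1 + fps_const c * fps_X ^ d) ^ K) $ (d * r) = of_nat (K choose r) * c ^ r"
proof -
  have "((1 + fps_const c * fps_X ^ d) ^ K) = (fps_const c * fps_X ^ d + 1) ^ K"
    by (simp add: add.commute)
  also have "\<dots> = (\<Sum>i\<le>K. of_nat (K choose i) * (fps_const c * fps_X ^ d) ^ i)"
    by (simp add: binomial_ring)
  also have "\<dots> = (\<Sum>i\<le>K. fps_const (of_nat (K choose i) * c ^ i) * fps_X ^ (d * i))"
    by (simp add: power_mult_distrib power_mult fps_of_nat fps_const_power mult.assoc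
        flip: fps_const_mult)
  finally have "((1 + fps_const c * fps_X ^ d) ^ K) $ (d * r) =
      (\<Sum>i\<le>K. of_nat (K choose i) * c ^ i * (if d * r = d * i then 1 else 0))"
    by (simp add: fps_sum_nth fps_X_power_nth)
  also have "\<dots> = (\<Sum>i\<le>K. if r = i then of_nat (K choose i) * c ^ i else 0)"
    using assms by (intro sum.cong) auto
  finally show ?thesis using assms by simp
qed

lemma gauss_val_ge_log_series_power_diff:
  assumes "prime p"
  shows "gauss_val_ge p 1 (log_series ^ K * inverse (1 + fps_X) -
    (1 + fps_const ((-1) ^ (p - 1) / of_nat p) * fps_X ^ (p - 1)) ^ K)"
proof -
  define A :: "rat fps" where "A = 1 + fps_const ((-1) ^ (p - 1) / of_nat p) * fps_X ^ (p - 1)"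
  have p2: "p \<ge> 2" using assms by (rule prime_ge_2_nat)
  have M: "gauss_val_ge p 0 log_series"
    unfolding gauss_val_ge_def log_series_def
    using scaled_val_ge_log_coeff(1)[OF assms] by simp
  have MA: "gauss_val_ge p 1 (log_series - A)"
    unfolding gauss_val_ge_def
  proof
    fix j
    show "scaled_val_ge p (1 - int j) ((log_series - A) $ j)"
    proof (cases "j = 0 \<or> j = p - 1")
      case True
      then have "(log_series - A) $ j = 0"
        unfolding A_def log_series_def using p2 by (auto simp: of_nat_diff)
      then show ?thesis using assms by simp
    next
      case False
      then have "(log_series - A) $ j = (-1) ^ j / of_nat (Suc j)"
        unfolding A_def log_series_def by (simp add: fps_one_nth)
      then show ?thesis using False scaled_val_ge_log_coeff(2)[OF assms] by simp
    qed
  qed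
  have A: "gauss_val_ge p 0 A"
  proof -
    \<comment> \<open>Level 1 implies level 0, so \<open>A\<close> inherits level 0 from
      \<open>log_series\<close>.\<close>
    have "gauss_val_ge p 0 (log_series - A)"
      using MA unfolding gauss_val_ge_def scaled_val_ge_def by (meson diff_right_mono order_trans zero_le_one)
    then have "gauss_val_ge p 0 (log_series + - (log_series - A))"
      by (intro gauss_val_ge_add gauss_val_ge_uminus assms M)
    then show ?thesis by simp
  qed
  have W: "gauss_val_ge p 1 (inverse (1 + fps_X) - 1)"
    unfolding gauss_val_ge_def
  proof
    fix j
    \<comment> \<open>Subtracting 1 cancels the constant term. The other coefficients are signs, for
      which the bound \<open>1 - j \<le> 0\<close> suffices.\<close>
    show "scaled_val_ge p (1 - int j) ((inverse (1 + fps_X) - 1) $ j)"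
      using scaled_val_ge_of_int[OF assms, of "1 - int j" "(-1) ^ j"] assms
      by (cases j) (simp_all add: fps_inverse_fps_X_plus1)
  qed
  have "gauss_val_ge p (0 + 1) (log_series ^ K * (inverse (1 + fps_X) - 1))"
    using assms M W by (intro gauss_val_ge_mult gauss_val_ge_power)
  then have "gauss_val_ge p 1 (log_series ^ K * (inverse (1 + fps_X) - 1) + (log_series ^ K - A ^ K))"
    using assms M A MA by (intro gauss_val_ge_add gauss_val_ge_power_diff) simp_all
  then show ?thesis by (simp add: A_def algebra_simps)
qed

text \<open>The conclusion says that the coefficient has valuation exactly \<open>-r\<close>. After
  multiplication by \<open>p ^ r\<close>, the binomial term becomes an integer prime to
  \<open>p\<close>, while the error term becomes divisible by \<open>p\<close> up to a denominator
  \<open>b\<close> prime to \<open>p\<close>.\<close>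

lemma log_series_power_coeff:
  assumes "prime p" "r \<le> K" "\<not> p dvd (K choose r)"
  obtains u b :: int where "\<not> int p dvd u" "\<not> int p dvd b"
    "(log_series ^ K * inverse (1 + fps_X)) $ ((p - 1) * r) * of_int (int p ^ r * b) = of_int u"
proof -
  define m where "m = (p - 1) * r"
  define x where "x = (log_series ^ K * inverse (1 + fps_X)) $ m"
  define s :: int where "s = (-1) ^ ((p - 1) * r)"
  define y where "y = x - of_nat (K choose r) * ((-1) ^ (p - 1) / of_nat p) ^ r"
  have p2: "p \<ge> 2" using assms(1) by (rule prime_ge_2_nat)
  have "y = (log_series ^ K * inverse (1 + fps_X) -
    (1 + fps_const ((-1) ^ (p - 1) / of_nat p) * fps_X ^ (p - 1)) ^ K) $ m"
    unfolding y_def x_def m_def fps_sub_nth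
    using p2 assms(2) by (subst fps_nth_power_one_plus_monom) simp_all
  then have "scaled_val_ge p (1 - int m) y"
    using gauss_val_ge_log_series_power_diff[OF assms(1), of K] by (simp add: gauss_val_ge_def)
  \<comment> \<open>The scaled valuation of \<open>p ^ r\<close> is \<open>(p - 1) r = m\<close>,
    which raises the error bound \<open>1 - m\<close> to exactly 1.\<close>
  moreover have "scaled_val_ge p (int m) (of_nat p ^ r)"
    using p2 by (intro scaled_val_geI[of p 1 _ "int r" _ 1]) (simp_all add: m_def of_nat_diff)
  ultimately have "scaled_val_ge p ((1 - int m) + int m) (y * of_nat p ^ r)"
    by (rule scaled_val_ge_mult[OF assms(1)])
  then have "scaled_val_ge p 1 (y * of_nat p ^ r)" by simp
  moreover have "1 \<le> p" using p2 by simp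
  ultimately obtain a b where
    ab: "\<not> int p dvd b" "y * of_nat p ^ r * of_int b = of_int (int p * a)"
    by (rule scaled_val_ge_pos)
  have "x * of_nat p ^ r = of_int (s * int (K choose r)) + y * of_nat p ^ r"
    unfolding y_def s_def power_mult using p2 by (simp add: power_divide field_simps)
  then have "x * of_nat p ^ r * of_int b =
      of_int (s * int (K choose r)) * of_int b + y * of_nat p ^ r * of_int b"
    by (simp only: distrib_right)
  then have "x * of_int (int p ^ r * b) = of_int (s * int (K choose r) * b + int p * a)"
    unfolding ab(2) by (simp add: mult_ac)
  moreover have "\<not> int p dvd s * int (K choose r) * b + int p * a"
  proof -
    have "\<not> int p dvd s" unfolding s_def using p2 by (simp add: minus_one_power_iff)
    then have "\<not> int p dvd s * int (K choose r) * b"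
      using assms(1,3) ab(1) by (simp add: prime_dvd_mult_iff)
    then show ?thesis by (simp add: dvd_add_left_iff)
  qed
  ultimately show ?thesis using ab(1) that unfolding x_def m_def by blast
qed

section \<open>Comparing valuations\<close>

theorem theorem3p2:
  fixes p a h k n :: nat
  assumes "prime p"
    and "1 \<le> a" and "a \<le> p - 1"
    and "k = a * p ^ h"
    and "k \<le> n" and "n < k * p"
    and "(p - 1) dvd (n - k)"
  shows "minimum_zero_case p n k"
proof -
  have p2: "p \<ge> 2" using assms(1) by (rule prime_ge_2_nat)
  have k1: "k \<ge> 1" using assms(2,4) p2 by simp
  obtain r where r: "n - k = (p - 1) * r" using assms(7) by (elim dvdE)
  \<comment> \<open>The upper bound on \<open>n\<close> is what puts \<open>r\<close> in the range
    where the binomial coefficient is nonzero and prime to \<open>p\<close>.\<close>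
  have "n - k < k * p - k" using assms(5,6) by linarith
  also have "k * p - k = (p - 1) * k" by (simp add: diff_mult_distrib diff_mult_distrib2 mult.commute)
  finally have "(p - 1) * r < (p - 1) * k" unfolding r .
  then have rk: "r < k" by simp
  have "a < p" using assms(3) p2 by linarith
  then have "\<not> p dvd ((k - 1) choose r)"
    unfolding assms(4) using rk assms(4)
    by (intro binomial_digit_prime_power_not_dvd[OF assms(1)]) simp_all
  moreover have "r \<le> k - 1" using rk by simp
  ultimately obtain u b where ub: "\<not> int p dvd u" "\<not> int p dvd b"
    "(log_series ^ (k - 1) * inverse (1 + fps_X)) $ (n - k) * of_int (int p ^ r * b) = of_int u"
    unfolding r using log_series_power_coeff[OF assms(1)] by blast
  define S where "S = signed_stirling n k"
  \<comment> \<open>Clearing denominators gives an integer identity in which \<open>u\<close> and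
    \<open>b\<close> do not affect the valuation.\<close>
  have "of_int S * fact (k - 1) * of_int (int p ^ r * b) = (fact (n - 1) * of_int u :: rat)"
    unfolding S_def signed_stirling_log_series[OF k1 assms(5)] ub(3)[symmetric] by (simp add: mult_ac)
  then have "(of_int (b * (S * (fact (k - 1) * int p ^ r))) :: rat) = of_int (u * fact (n - 1))"
    by (simp add: mult_ac)
  then have eq: "b * (S * (fact (k - 1) * int p ^ r)) = u * fact (n - 1)"
    by (simp only: of_int_eq_iff)
  have pe: "prime_elem (int p)" using assms(1) by simp
  have "u * fact (n - 1) \<noteq> 0" using ub(1) by auto
  then have S0: "S \<noteq> 0" using eq by auto
  have "multiplicity (int p) (b * (S * (fact (k - 1) * int p ^ r))) =
      multiplicity (int p) S + (multiplicity (int p) (fact (k - 1)) + r)"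
    unfolding multiplicity_prime_elem_times_other[OF pe ub(2)]
    using S0 p2 by (simp add: prime_elem_multiplicity_mult_distrib[OF pe] multiplicity_same_power)
  then have mult: "multiplicity (int p) S + multiplicity (int p) (fact (k - 1)) + r =
      multiplicity (int p) (fact (n - 1))"
    unfolding eq multiplicity_prime_elem_times_other[OF pe ub(1)] by simp
  \<comment> \<open>In the difference of Legendre's formulas for \<open>n - 1\<close> and
    \<open>k - 1\<close>, the term \<open>n - k\<close> cancels against \<open>(p - 1) * r\<close>,
    leaving only the digit sums.\<close>
  have "(p - 1) * multiplicity (int p) S + digit_sum p (n - 1) = digit_sum p (k - 1)"
    using legendre_digit_sum[OF assms(1), of "k - 1"] legendre_digit_sum[OF assms(1), of "n - 1"]
      r k1 assms(5) unfolding mult[symmetric] distrib_left by linarith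
  from arg_cong[OF this, of real]
  have "(real p - 1) * real (multiplicity (int p) S) =
      real (digit_sum p (k - 1)) - real (digit_sum p (n - 1))"
    using p2 by (simp add: of_nat_diff)
  then show ?thesis
    unfolding minimum_zero_case_def using S0 p2 by (simp add: S_def field_simps)
qed

end
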